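(* Let $r>0$ be given and let $x_0\in\mathcal{B}(r)$ be an initial condition. Let $\delta>0$ and $\alpha\in\mathcal{A}$ be given. Consider the set $$\mathcal{Y}_\alpha:=\left\{Y\in\mathbb{R}^{n\times n} : Y\succ0,\ \begin{bmatrix}\delta & x_0' \\ x_0 & Y\end{bmatrix}\succ0,\ \mathcal{N}_{\hat B}'\,\Omega_\alpha(Y)\,\mathcal{N}_{\hat B}\prec0\right\},$$ where $$\Omega_\alpha(Y):=\begin{bmatrix}YA'+AY&(\sqrt{Q_\alpha}\,Y)'&0_{n\times m}\\ \sqrt{Q_\alpha}\,Y&-I_n&0_{n\times m}\\ 0_{m\times n}&0_{m\times n}&-R_\alpha^{-1}\end{bmatrix}$$ and $\mathcal{N}_{\hat B}$ is a matrix with orthonormal columns spanning the null space of $\hat B=[B'\ \ 0_{m\times n}\ \ I_m]$. Define $$\mathcal{P}_\alpha:=\{P_\alpha\in\mathbb{R}^{n\times n} : P_\alpha\succ0,\ P_\alpha^{-1}\in\mathcal{Y}_\alpha\}.$$ Suppose that $\mathcal{P}_\alpha\neq\emptyset$. For any $P_\alpha\in\mathcal{P}_\alpha$, if there exists $F\in\mathbb{R}^{m\times n}$ satisfying $$\begin{bmatrix}(A+BF)'P_\alpha+P_\alpha(A+BF)&(\sqrt{Q_\alpha})'&(\sqrt{R_\alpha}F)'\\ \sqrt{Q_\alpha}&-I_n&0_{n\times m}\\ \sqrt{R_\alpha}F&0_{m\times n}&-I_m\end{bmatrix}\prec0,$$ $$G_iF\bigl(I_n-C_i'(C_iC_i')^{-1}C_i\bigr)=0\quad\text{for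 all }i\in\mathsf N,$$ then $F\in\hat{\mathfrak g}_\alpha(\delta)$ and $A+BF$ is Hurwitz.
   Context: Notation: $'$ denotes transpose; $M\succ0$ (resp. $M\succeq 0$, $M\prec0$) means positive definite (resp. positive semidefinite, negative definite); $\sqrt{M}$ is the symmetric positive semidefinite square root of $M\succeq0$; $\oplus$ is the direct sum of matrices; a square real matrix is Hurwitz if all its eigenvalues have negative real parts; $\mathcal{B}(r)=\{z\in\mathbb{R}^n : \|z\|\le r\}$. Setting (infinite-horizon linear-quadratic cooperative differential game): $\mathsf N=\{1,\dots,N\}$ is the set of players. The data are $A\in\mathbb{R}^{n\times n}$, $B_i\in\mathbb{R}^{n\times m_i}$, $C_i\in\mathbb{R}^{s_i\times n}$ with $\mathrm{rank}(C_i)=s_i\le n$, $Q_i\in\mathbb{R}^{s_i\times s_i}$ with $Q_i\succeq0$, and $R_i\in\mathbb{R}^{m_i\times m_i}$ with $R_i\succ0$, $i\in\mathsf N$. Player $i$ observes only $y_i=C_ix$ and uses static output feedback $u_i=F_iy_i$. Let $m=m_1+\cdots+m_N$ and $B=[B_1\ B_2\ \cdots\ B_N]\in\mathbb{R}^{n\times m}$; $(A,B)$ is assumed stabilizable. Let $G_i=[0_{m_i\times m_1}\ \cdots\ I_{m_i}\ \cdots\ 0_{m_i\times m_N}]\in\mathbb{R}^{m_i\times m}$ (identity in the $i$-th block). Weights: $\mathcal{A}=\{\alpha=(\alpha_1,\dots,\alpha_N) : \alpha_i\in(0,1),\ \sum_{i\in\mathsf N}\alpha_i=1\}$. For $\alpha\in\mathcal{A}$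 let $Q_\alpha=\sum_{i\in\mathsf N}C_i'(\alpha_iQ_i)C_i$ and $R_\alpha=\oplus_{i\in\mathsf N}\alpha_iR_i\in\mathbb{R}^{m\times m}$. Cost: for $F\in\mathbb{R}^{m\times n}$ and an initial condition $z\in\mathbb{R}^n$, let $x(t)$ solve $\dot x=(A+BF)x$, $x(0)=z$, let $u(t)=Fx(t)$, and let $J_\alpha(z,F)=\int_0^\infty (x(t)'Q_\alpha x(t)+u(t)'R_\alpha u(t))\,dt$. Guaranteed cost problem under consideration: given $r>0$, $\alpha\in\mathcal{A}$, $\delta>0$, find $F\in\mathbb{R}^{m\times n}$ with $G_iF\bigl(I_n-C_i'(C_iC_i')^{-1}C_i\bigr)=0$ for all $i\in\mathsf N$, $J_\alpha(z,F)<\delta$ for all $z\in\mathcal{B}(r)$, and $A+BF$ Hurwitz. For $\delta>0$ and $\alpha\in\mathcal{A}$: $\hat{\mathfrak g}_\alpha(\delta)$ (the guaranteed cost structured control set) is the set of all $F\in\mathbb{R}^{m\times n}$ such that $G_iF\bigl(I_n-C_i'(C_iC_i')^{-1}C_i\bigr)=0$ for all $i\in\mathsf N$ and $J_\alpha(z,F)<\delta$ for all initial conditions $z\in\mathcal{B}(r)$.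
   Formalization: With one fixed x_0 (e.g. x_0=0) the claim is false; F in the guaranteed cost set is concluded only when P_α lies in the set 𝒫_α for every x_0 in B(r), while for one fixed x_0 only J_α(x_0,F)<δ and A+BF Hurwitz are concluded. *)

theory Defs
  imports "HOL-Analysis.Analysis"
    "Jordan_Normal_Form.Matrix_Kernel"
    "Jordan_Normal_Form.DL_Rank"
    "Jordan_Normal_Form.Char_Poly"
begin

text \<open>
  The block sizes depend on the player, so vectors and matrices are those with
  explicit carriers rather than those indexed by finite types.  The operations whose
  infix notation the two libraries share are written in prefix form.
\<close>

type_synonym rmat = "real Matrix.mat"
type_synonym rvec = "real Matrix.vec"

section \<open>Matrices\<close>

text \<open>Definiteness always includes symmetry.\<close>

definition pos_def :: "nat \<Rightarrow> rmat \<Rightarrow> bool" where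
  "pos_def d M \<longleftrightarrow> M \<in> carrier_mat d d \<and> transpose_mat M = M \<and>
     (\<forall>v\<in>carrier_vec d. v \<noteq> 0\<^sub>v d \<longrightarrow> scalar_prod v (M *\<^sub>v v) > 0)"

definition pos_semidef :: "nat \<Rightarrow> rmat \<Rightarrow> bool" where
  "pos_semidef d M \<longleftrightarrow> M \<in> carrier_mat d d \<and> transpose_mat M = M \<and>
     (\<forall>v\<in>carrier_vec d. scalar_prod v (M *\<^sub>v v) \<ge> 0)"

definition neg_def :: "nat \<Rightarrow> rmat \<Rightarrow> bool" where
  "neg_def d M \<longleftrightarrow> M \<in> carrier_mat d d \<and> transpose_mat M = M \<and>
     (\<forall>v\<in>carrier_vec d. v \<noteq> 0\<^sub>v d \<longrightarrow> scalar_prod v (M *\<^sub>v v) < 0)"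

text \<open>Only meaningful for positive semidefinite \<open>M\<close>, where such an \<open>S\<close> exists and is unique.\<close>

definition mat_sqrt :: "rmat \<Rightarrow> rmat" where
  "mat_sqrt M = (SOME S. pos_semidef (dim_row M) S \<and> S * S = M)"

text \<open>Only meaningful for invertible \<open>M\<close>.\<close>

definition mat_inv :: "rmat \<Rightarrow> rmat" where
  "mat_inv M = the (mat_inverse M)"

definition hurwitz :: "rmat \<Rightarrow> bool" where
  "hurwitz M \<longleftrightarrow> (\<forall>\<mu>. eigenvalue (map_mat complex_of_real M) \<mu> \<longrightarrow> Re \<mu> < 0)"

definition block_row :: "nat \<Rightarrow> rmat list \<Rightarrow> rmat" where
  "block_row d Ms = mat_of_cols d (concat (map cols Ms))"

definition block_col :: "nat \<Rightarrow> rmat list \<Rightarrow> rmat" where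
  "block_col d Ms = mat_of_rows d (concat (map rows Ms))"

definition orthonormal_basis_mat :: "nat \<Rightarrow> rvec set \<Rightarrow> rmat \<Rightarrow> bool" where
  "orthonormal_basis_mat d V W \<longleftrightarrow> dim_row W = d \<and>
     transpose_mat W * W = 1\<^sub>m (dim_col W) \<and> vec_space.col_space d W = V"

section \<open>The game\<close>

text \<open>
  Players are \<open>0, \<dots>, num_players - 1\<close>; values of the families at other indices are irrelevant.
\<close>

record lq_game =
  num_players :: nat
  xdim :: nat
  udim :: "nat \<Rightarrow> nat"
  ydim :: "nat \<Rightarrow> nat"
  matA :: rmat
  matB :: "nat \<Rightarrow> rmat"
  matC :: "nat \<Rightarrow> rmat"
  matQ :: "nat \<Rightarrow> rmat"
  matR :: "nat \<Rightarrow> rmat"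

definition total_udim :: "lq_game \<Rightarrow> nat" where
  "total_udim g = (\<Sum>i<num_players g. udim g i)"

definition full_B :: "lq_game \<Rightarrow> rmat" where
  "full_B g = block_row (xdim g) (map (matB g) [0..<num_players g])"

definition closed_loop :: "lq_game \<Rightarrow> rmat \<Rightarrow> rmat" where
  "closed_loop g F = matA g + full_B g * F"

definition stabilizable :: "lq_game \<Rightarrow> bool" where
  "stabilizable g \<longleftrightarrow>
     (\<exists>K\<in>carrier_mat (total_udim g) (xdim g). hurwitz (closed_loop g K))"

definition valid_game :: "lq_game \<Rightarrow> bool" where
  "valid_game g \<longleftrightarrow>
     matA g \<in> carrier_mat (xdim g) (xdim g) \<and>
     (\<forall>i<num_players g.
        matB g i \<in> carrier_mat (xdim g) (udim g i) \<and>
        matC g i \<in> carrier_mat (ydim g i) (xdim g) \<and>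
        vec_space.rank (ydim g i) (matC g i) = ydim g i \<and> ydim g i \<le> xdim g \<and>
        pos_semidef (ydim g i) (matQ g i) \<and>
        pos_def (udim g i) (matR g i)) \<and>
     stabilizable g"

text \<open>The selector \<open>[0 \<dots> I \<dots> 0]\<close> of the input block of player \<open>i\<close>.\<close>

definition selector :: "lq_game \<Rightarrow> nat \<Rightarrow> rmat" where
  "selector g i = block_row (udim g i)
     (map (\<lambda>j. if j = i then 1\<^sub>m (udim g i) else 0\<^sub>m (udim g i) (udim g j))
        [0..<num_players g])"

text \<open>
  The gains \<open>F\<close> whose \<open>i\<close>-th block of rows factors through \<open>C\<^sub>i\<close>
  (static output feedback of player \<open>i\<close>).
\<close>

definition structured :: "lq_game \<Rightarrow> rmat \<Rightarrow> bool" where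
  "structured g F \<longleftrightarrow> (\<forall>i<num_players g.
     let C = matC g i in
       selector g i * F *
         (1\<^sub>m (xdim g) - transpose_mat C * mat_inv (C * transpose_mat C) * C)
       = 0\<^sub>m (udim g i) (xdim g))"

definition weights :: "lq_game \<Rightarrow> (nat \<Rightarrow> real) set" where
  "weights g = {\<alpha>. (\<forall>i<num_players g. 0 < \<alpha> i \<and> \<alpha> i < 1) \<and> (\<Sum>i<num_players g. \<alpha> i) = 1}"

definition Q_weighted :: "lq_game \<Rightarrow> (nat \<Rightarrow> real) \<Rightarrow> rmat" where
  "Q_weighted g \<alpha> = foldr (+)
     (map (\<lambda>i. transpose_mat (matC g i) * (\<alpha> i \<cdot>\<^sub>m matQ g i) * matC g i) [0..<num_players g])
     (0\<^sub>m (xdim g) (xdim g))"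

definition R_weighted :: "lq_game \<Rightarrow> (nat \<Rightarrow> real) \<Rightarrow> rmat" where
  "R_weighted g \<alpha> = diag_block_mat (map (\<lambda>i. \<alpha> i \<cdot>\<^sub>m matR g i) [0..<num_players g])"

section \<open>Cost and guaranteed cost\<close>

definition solves_linear_ode :: "rmat \<Rightarrow> rvec \<Rightarrow> (real \<Rightarrow> rvec) \<Rightarrow> bool" where
  "solves_linear_ode M z x \<longleftrightarrow> x 0 = z \<and>
     (\<forall>t\<ge>0. x t \<in> carrier_vec (dim_row M)) \<and>
     (\<forall>t\<ge>0. \<forall>k<dim_row M.
        ((\<lambda>\<tau>. vec_index (x \<tau>) k) has_real_derivative vec_index (M *\<^sub>v x t) k) (at t within {0..}))"

text \<open>On \<open>[0, \<infinity>)\<close> the solution exists and is unique.\<close>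

definition state_trajectory :: "lq_game \<Rightarrow> rmat \<Rightarrow> rvec \<Rightarrow> real \<Rightarrow> rvec" where
  "state_trajectory g F z = (SOME x. solves_linear_ode (closed_loop g F) z x)"

text \<open>
  The integrand is nonnegative; the integral takes values in \<open>[0, \<infinity>]\<close>, so that gains
  of infinite cost do not get the default value \<open>0\<close> of a non-convergent integral.
\<close>

definition cost :: "lq_game \<Rightarrow> (nat \<Rightarrow> real) \<Rightarrow> rvec \<Rightarrow> rmat \<Rightarrow> ennreal" where
  "cost g \<alpha> z F =
     (\<integral>\<^sup>+t\<in>{0..}. ennreal
        (let x = state_trajectory g F z t; u = F *\<^sub>v x in
           scalar_prod x (Q_weighted g \<alpha> *\<^sub>v x) + scalar_prod u (R_weighted g \<alpha> *\<^sub>v u))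
      \<partial>lborel)"

definition init_ball :: "lq_game \<Rightarrow> real \<Rightarrow> rvec set" where
  "init_ball g r = {z \<in> carrier_vec (xdim g). sqrt (scalar_prod z z) \<le> r}"

definition guaranteed_cost_controls ::
    "lq_game \<Rightarrow> (nat \<Rightarrow> real) \<Rightarrow> real \<Rightarrow> real \<Rightarrow> rmat set" where
  "guaranteed_cost_controls g \<alpha> r \<delta> =
     {F \<in> carrier_mat (total_udim g) (xdim g).
        structured g F \<and> (\<forall>z\<in>init_ball g r. cost g \<alpha> z F < ennreal \<delta>)}"

section \<open>Matrix inequalities\<close>

definition hat_B :: "lq_game \<Rightarrow> rmat" where
  "hat_B g = block_row (total_udim g)
     [transpose_mat (full_B g), 0\<^sub>m (total_udim g) (xdim g), 1\<^sub>m (total_udim g)]"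

definition null_basis_hat_B :: "lq_game \<Rightarrow> rmat \<Rightarrow> bool" where
  "null_basis_hat_B g W \<longleftrightarrow>
     orthonormal_basis_mat (xdim g + xdim g + total_udim g) (mat_kernel (hat_B g)) W"

definition Omega :: "lq_game \<Rightarrow> (nat \<Rightarrow> real) \<Rightarrow> rmat \<Rightarrow> rmat" where
  "Omega g \<alpha> Y =
     (let n = xdim g; m = total_udim g; A = matA g; S = mat_sqrt (Q_weighted g \<alpha>) in
      block_col (n + n + m)
       [block_row n [Y * transpose_mat A + A * Y, transpose_mat (S * Y), 0\<^sub>m n m],
        block_row n [S * Y, - 1\<^sub>m n, 0\<^sub>m n m],
        block_row m [0\<^sub>m m n, 0\<^sub>m m n, - mat_inv (R_weighted g \<alpha>)]])"

text \<open>
  \<open>W\<close> is a matrix whose columns are an orthonormal basis of the null space of \<open>hat_B g\<close>.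
  The sets depend on the initial condition \<open>x0\<close>, and membership for one \<open>x0\<close> bounds the
  cost from that \<open>x0\<close> only; for the whole ball, \<open>P\<close> has to be in \<open>P_set\<close> for each of
  its points.
\<close>

definition Y_set ::
    "lq_game \<Rightarrow> (nat \<Rightarrow> real) \<Rightarrow> real \<Rightarrow> rmat \<Rightarrow> rvec \<Rightarrow> rmat set" where
  "Y_set g \<alpha> \<delta> W x0 =
     {Y. pos_def (xdim g) Y \<and>
         pos_def (1 + xdim g)
           (four_block_mat (mat 1 1 (\<lambda>_. \<delta>)) (mat_of_row x0) (mat_of_cols (xdim g) [x0]) Y) \<and>
         neg_def (dim_col W) (transpose_mat W * Omega g \<alpha> Y * W)}"

definition P_set ::
    "lq_game \<Rightarrow> (nat \<Rightarrow> real) \<Rightarrow> real \<Rightarrow> rmat \<Rightarrow> rvec \<Rightarrow> rmat set" where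
  "P_set g \<alpha> \<delta> W x0 = {P. pos_def (xdim g) P \<and> mat_inv P \<in> Y_set g \<alpha> \<delta> W x0}"

definition gain_LMI :: "lq_game \<Rightarrow> (nat \<Rightarrow> real) \<Rightarrow> rmat \<Rightarrow> rmat \<Rightarrow> bool" where
  "gain_LMI g \<alpha> P F \<longleftrightarrow>
     (let n = xdim g; m = total_udim g; M = closed_loop g F;
          S = mat_sqrt (Q_weighted g \<alpha>); T = mat_sqrt (R_weighted g \<alpha>) in
      neg_def (n + n + m)
       (block_col (n + n + m)
         [block_row n [transpose_mat M * P + P * M, transpose_mat S, transpose_mat (T * F)],
          block_row n [S, - 1\<^sub>m n, 0\<^sub>m n m],
          block_row m [T * F, 0\<^sub>m m n, - 1\<^sub>m m]]))"

end

theory Submission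
  imports Defs
begin

text \<open>
  Along \<open>dx/dt = (A + B F) x\<close>, and with \<open>'\<close> for the transpose, the quadratic form \<open>V(x) = x' P x\<close> is a storage function for the
  running cost.  Testing the block inequality for \<open>F\<close> at vectors of the form
  \<open>(v, \<surd>Q v, \<surd>R F v)\<close>, which amounts to taking the Schur complement of the two blocks \<open>-I\<close>,
  gives for \<open>v \<noteq> 0\<close>
    \<open>2 v' P (A + B F) v + v' Q v + (F v)' R (F v) < 0\<close>   (lemma \<open>gain_LMI_imp_dissipation\<close>).
  The first term is the derivative of \<open>V\<close> and the two others are the running cost, so
  everything follows from this inequality.

  Integrated over time it says that the cost from \<open>z\<close> is at most \<open>V(z) = z' P z\<close>, because \<open>V\<close>
  never becomes negative (\<open>gain_LMI_imp_cost_bound\<close>).  The bordered matrix with corner \<open>\<delta>\<close>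
  and lower block \<open>P\<^sup>-\<^sup>1\<close> is positive definite; at the vector \<open>(1, -P z)\<close> this reads
  \<open>z' P z < \<delta>\<close> (\<open>pos_def_bordered_inverse_imp_bound\<close>).  Applied to the real and the
  imaginary part of a complex eigenvector of \<open>A + B F\<close>, the same inequality makes the real part
  of the eigenvalue negative (\<open>hurwitz_of_lyapunov_inequality\<close>).

  The square roots of the weights and the trajectory are chosen by a description operator, so
  all of this rests on two existence results: every positive semidefinite matrix has a positive
  semidefinite square root (\<open>pos_semidef_square_root_exists\<close>), and a linear differential
  equation with constant coefficients has a solution (\<open>linear_ode_solution_exists\<close>).
\<close>

section \<open>Quadratic forms and semidefinite matrices\<close>

lemma scalar_prod_self_pos:
  fixes v :: rvec
  assumes "v \<in> carrier_vec n" "v \<noteq> 0\<^sub>v n"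
  shows "0 < scalar_prod v v"
proof -
  obtain i where i: "i < n" "vec_index v i \<noteq> 0"
    using assms by (metis carrier_vecD eq_vecI index_zero_vec)
  have "0 < (\<Sum>k\<in>{0..<n}. vec_index v k * vec_index v k)"
    using i by (intro sum_pos2[where i = i]) (auto simp: zero_less_mult_iff linorder_neq_iff)
  then show ?thesis
    using assms by (simp add: scalar_prod_def)
qed

lemma scalar_prod_self_nonneg: "0 \<le> scalar_prod v (v :: rvec)"
  by (simp add: scalar_prod_def sum_nonneg)

lemma scalar_prod_transpose_mult:
  fixes A :: rmat
  assumes "A \<in> carrier_mat p q" "x \<in> carrier_vec p" "y \<in> carrier_vec q"
  shows "scalar_prod x (A *\<^sub>v y) = scalar_prod (transpose_mat A *\<^sub>v x) y"
  using transpose_vec_mult_scalar[OF assms(1,3,2)] by simp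

lemma scalar_prod_symmetric:
  fixes A :: rmat
  assumes "A \<in> carrier_mat n n" "transpose_mat A = A" "x \<in> carrier_vec n" "y \<in> carrier_vec n"
  shows "scalar_prod x (A *\<^sub>v y) = scalar_prod y (A *\<^sub>v x)"
  using scalar_prod_transpose_mult[OF assms(1,3,4)] assms
    comm_scalar_prod[of "A *\<^sub>v x" n y]
  by simp

lemma pos_semidef_congruence:
  assumes A: "pos_semidef n A" and H: "H \<in> carrier_mat n k"
  shows "pos_semidef k (transpose_mat H * A * H)"
proof -
  have A': "A \<in> carrier_mat n n" "transpose_mat A = A"
    using A by (auto simp: pos_semidef_def)
  have "transpose_mat (transpose_mat H * A * H) = transpose_mat H * (transpose_mat A * H)"
    using A' H transpose_mult[of "transpose_mat H * A" k n H k] transpose_mult[of "transpose_mat H" k n A n]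
    by simp
  moreover have "scalar_prod v ((transpose_mat H * A * H) *\<^sub>v v) \<ge> 0" if v: "v \<in> carrier_vec k" for v
  proof -
    have "(transpose_mat H * A * H) *\<^sub>v v = transpose_mat H *\<^sub>v (A *\<^sub>v (H *\<^sub>v v))"
      using A' H v by (simp add: assoc_mult_mat_vec[of _ k n _ k] assoc_mult_mat_vec[of _ k n _ n])
    then have "scalar_prod v ((transpose_mat H * A * H) *\<^sub>v v) = scalar_prod (H *\<^sub>v v) (A *\<^sub>v (H *\<^sub>v v))"
      using scalar_prod_transpose_mult[of "transpose_mat H" k n v "A *\<^sub>v (H *\<^sub>v v)"] A' H v by simp
    then show ?thesis
      using A H v by (auto simp: pos_semidef_def)
  qed
  ultimately show ?thesis
    using A' H by (auto simp: pos_semidef_def assoc_mult_mat[of _ k n _ n _ k])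
qed

lemma pos_semidef_add:
  assumes A: "pos_semidef n A" and B: "pos_semidef n B"
  shows "pos_semidef n (A + B)"
proof -
  have c: "A \<in> carrier_mat n n" "B \<in> carrier_mat n n"
    using A B by (auto simp: pos_semidef_def)
  have "scalar_prod v ((A + B) *\<^sub>v v) \<ge> 0" if v: "v \<in> carrier_vec n" for v
  proof -
    have "scalar_prod v ((A + B) *\<^sub>v v) = scalar_prod v (A *\<^sub>v v) + scalar_prod v (B *\<^sub>v v)"
      using c v by (simp add: add_mult_distrib_mat_vec scalar_prod_add_distrib[of _ n])
    then show ?thesis
      using A B v by (simp add: pos_semidef_def)
  qed
  then show ?thesis
    using A B c by (simp add: pos_semidef_def transpose_add)
qed

lemma pos_semidef_smult:
  assumes A: "pos_semidef n A" and c: "0 \<le> (c :: real)"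
  shows "pos_semidef n (c \<cdot>\<^sub>m A)"
proof -
  have A': "A \<in> carrier_mat n n" "transpose_mat A = A"
    using A by (auto simp: pos_semidef_def)
  have "scalar_prod v ((c \<cdot>\<^sub>m A) *\<^sub>v v) \<ge> 0" if v: "v \<in> carrier_vec n" for v
  proof -
    have "(c \<cdot>\<^sub>m A) *\<^sub>v v = c \<cdot>\<^sub>v (A *\<^sub>v v)"
      using A' v by (intro eq_vecI) auto
    then show ?thesis
      using A A' v c by (simp add: pos_semidef_def)
  qed
  moreover have "transpose_mat (c \<cdot>\<^sub>m A) = c \<cdot>\<^sub>m transpose_mat A"
    by (intro eq_matI) auto
  ultimately show ?thesis
    using A' by (auto simp: pos_semidef_def)
qed

lemma pos_def_imp_pos_semidef:
  assumes "pos_def n A"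
  shows "pos_semidef n A"
  unfolding pos_semidef_def
proof (intro conjI ballI)
  fix v :: rvec assume "v \<in> carrier_vec n"
  then show "0 \<le> scalar_prod v (A *\<^sub>v v)"
    using assms by (cases "v = 0\<^sub>v n") (auto simp: pos_def_def less_imp_le)
qed (use assms in \<open>auto simp: pos_def_def\<close>)

lemma pos_semidef_zero: "pos_semidef n (0\<^sub>m n n)"
proof -
  have "0\<^sub>m n n *\<^sub>v v = 0\<^sub>v n" if "v \<in> carrier_vec n" for v :: rvec
    using that by (intro eq_vecI) auto
  then show ?thesis
    by (simp add: pos_semidef_def zero_transpose_mat)
qed

lemma scalar_prod_four_block_diag:
  assumes A: "A \<in> carrier_mat p p" and B: "B \<in> carrier_mat q q"
    and x: "x \<in> carrier_vec p" and y: "(y :: rvec) \<in> carrier_vec q"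
  shows "scalar_prod (x @\<^sub>v y) (four_block_mat A (0\<^sub>m p q) (0\<^sub>m q p) B *\<^sub>v (x @\<^sub>v y))
    = scalar_prod x (A *\<^sub>v x) + scalar_prod y (B *\<^sub>v y)"
proof -
  have "four_block_mat A (0\<^sub>m p q) (0\<^sub>m q p) B *\<^sub>v (x @\<^sub>v y) = (A *\<^sub>v x) @\<^sub>v (B *\<^sub>v y)"
    by (rule mult_mat_vec_split[OF A B x y])
  then show ?thesis
    using A B x y by (simp add: scalar_prod_append[of _ p _ q])
qed

lemma pos_semidef_four_block_diag:
  assumes A: "pos_semidef p A" and B: "pos_semidef q B"
  shows "pos_semidef (p + q) (four_block_mat A (0\<^sub>m p q) (0\<^sub>m q p) B)"
  unfolding pos_semidef_def
proof (intro conjI ballI)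
  have c: "A \<in> carrier_mat p p" "B \<in> carrier_mat q q"
    and t: "transpose_mat A = A" "transpose_mat B = B"
    using A B by (auto simp: pos_semidef_def)
  show "four_block_mat A (0\<^sub>m p q) (0\<^sub>m q p) B \<in> carrier_mat (p + q) (p + q)"
    using c by simp
  show "transpose_mat (four_block_mat A (0\<^sub>m p q) (0\<^sub>m q p) B) = four_block_mat A (0\<^sub>m p q) (0\<^sub>m q p) B"
    using c t by (simp add: transpose_four_block_mat[of _ p p _ q _ q] zero_transpose_mat)
  fix v :: rvec assume v: "v \<in> carrier_vec (p + q)"
  then have "scalar_prod v (four_block_mat A (0\<^sub>m p q) (0\<^sub>m q p) B *\<^sub>v v)
      = scalar_prod (vec_first v p) (A *\<^sub>v vec_first v p) + scalar_prod (vec_last v q) (B *\<^sub>v vec_last v q)"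
    using scalar_prod_four_block_diag[OF c, of "vec_first v p" "vec_last v q"] by simp
  then show "0 \<le> scalar_prod v (four_block_mat A (0\<^sub>m p q) (0\<^sub>m q p) B *\<^sub>v v)"
    using A B by (simp add: pos_semidef_def)
qed

lemma pos_semidef_diag_block_mat:
  assumes "\<And>M. M \<in> set Ms \<Longrightarrow> pos_semidef (dim_row M) M"
  shows "pos_semidef (dim_row (diag_block_mat Ms)) (diag_block_mat Ms)"
  using assms
proof (induction Ms)
  case Nil
  then show ?case by (simp add: pos_semidef_zero)
next
  case (Cons M Ms)
  let ?D = "diag_block_mat Ms"
  have M: "pos_semidef (dim_row M) M" and D: "pos_semidef (dim_row ?D) ?D"
    using Cons by auto
  then have "dim_col M = dim_row M" "dim_col ?D = dim_row ?D"
    by (auto simp: pos_semidef_def)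
  then show ?case
    using pos_semidef_four_block_diag[OF M D] by (simp add: Let_def)
qed

section \<open>Eigenvectors of real matrices\<close>

text \<open>
  Separates \<open>A (a + i b) = \<mu> (a + i b)\<close> into real and imaginary parts, so that both the
  construction of square roots and the stability argument can work with real quadratic forms.
\<close>

lemma complex_eigenvector_real_parts:
  assumes A: "(A :: rmat) \<in> carrier_mat n n"
    and ev: "eigenvalue (map_mat complex_of_real A) \<mu>"
  obtains a b where "a \<in> carrier_vec n" "b \<in> carrier_vec n" "a \<noteq> 0\<^sub>v n \<or> b \<noteq> 0\<^sub>v n"
    "A *\<^sub>v a = Re \<mu> \<cdot>\<^sub>v a - Im \<mu> \<cdot>\<^sub>v b"
    "A *\<^sub>v b = Im \<mu> \<cdot>\<^sub>v a + Re \<mu> \<cdot>\<^sub>v b"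
proof -
  obtain w where w: "w \<in> carrier_vec n" "w \<noteq> 0\<^sub>v n"
    and e: "map_mat complex_of_real A *\<^sub>v w = \<mu> \<cdot>\<^sub>v w"
    using ev A by (auto simp: eigenvalue_def eigenvector_def)
  define a where "a = map_vec Re w"
  define b where "b = map_vec Im w"
  have c: "a \<in> carrier_vec n" "b \<in> carrier_vec n"
    using w by (auto simp: a_def b_def)
  have nz: "a \<noteq> 0\<^sub>v n \<or> b \<noteq> 0\<^sub>v n"
  proof (rule ccontr)
    assume "\<not> ?thesis"
    then have ab: "a = 0\<^sub>v n" "b = 0\<^sub>v n" by auto
    have "vec_index w i = 0" if "i < n" for i
    proof -
      have "vec_index a i = 0" "vec_index b i = 0"
        unfolding ab using that by auto
      then show ?thesis
        using that w by (auto simp: a_def b_def complex_eq_iff)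
    qed
    then have "w = 0\<^sub>v n"
      using w by (intro eq_vecI) auto
    then show False using w by simp
  qed
  have row: "(\<Sum>j\<in>{0..<n}. complex_of_real (A $$ (i, j)) * vec_index w j) = \<mu> * vec_index w i" if "i < n" for i
  proof -
    have "vec_index (map_mat complex_of_real A *\<^sub>v w) i = vec_index (\<mu> \<cdot>\<^sub>v w) i"
      using e by simp
    then show ?thesis
      using that A w by (simp add: scalar_prod_def)
  qed
  have "A *\<^sub>v a = Re \<mu> \<cdot>\<^sub>v a - Im \<mu> \<cdot>\<^sub>v b"
  proof (intro eq_vecI)
    fix i assume "i < dim_vec (Re \<mu> \<cdot>\<^sub>v a - Im \<mu> \<cdot>\<^sub>v b)"
    then have i: "i < n" using c by simp
    then show "vec_index (A *\<^sub>v a) i = vec_index (Re \<mu> \<cdot>\<^sub>v a - Im \<mu> \<cdot>\<^sub>v b) i"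
      using arg_cong[OF row[OF i], of Re] A w by (simp add: a_def b_def scalar_prod_def)
  qed (use A c in auto)
  moreover have "A *\<^sub>v b = Im \<mu> \<cdot>\<^sub>v a + Re \<mu> \<cdot>\<^sub>v b"
  proof (intro eq_vecI)
    fix i assume "i < dim_vec (Im \<mu> \<cdot>\<^sub>v a + Re \<mu> \<cdot>\<^sub>v b)"
    then have i: "i < n" using c by simp
    then show "vec_index (A *\<^sub>v b) i = vec_index (Im \<mu> \<cdot>\<^sub>v a + Re \<mu> \<cdot>\<^sub>v b) i"
      using arg_cong[OF row[OF i], of Im] A w by (simp add: a_def b_def scalar_prod_def)
  qed (use A c in auto)
  ultimately show thesis
    using that c nz by blast
qed

text \<open>
  A complex eigenvalue exists by the fundamental theorem of algebra.  Evaluating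
  \<open>b' A a = a' A b\<close> on the real and imaginary parts \<open>a\<close>, \<open>b\<close> of its eigenvector gives
  \<open>Im \<mu> (a' a + b' b) = 0\<close>; so \<open>\<mu>\<close> is real, and a nonzero one of \<open>a\<close>, \<open>b\<close> is an eigenvector.
\<close>

lemma symmetric_real_eigenvector:
  assumes A: "(A :: rmat) \<in> carrier_mat n n" "transpose_mat A = A" and n: "0 < n"
  obtains e v where "v \<in> carrier_vec n" "scalar_prod v v = 1" "A *\<^sub>v v = e \<cdot>\<^sub>v v"
proof -
  let ?C = "map_mat complex_of_real A"
  have C: "?C \<in> carrier_mat n n" using A by simp
  then have "degree (char_poly ?C) = n"
    using degree_monic_char_poly by blast
  then obtain \<mu> where "poly (char_poly ?C) \<mu> = 0"
    using n fundamental_theorem_of_algebra[of "char_poly ?C"] by (auto simp: constant_degree)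
  then have "eigenvalue ?C \<mu>"
    using eigenvalue_root_char_poly[OF C] by simp
  then obtain a b where c: "a \<in> carrier_vec n" "b \<in> carrier_vec n"
    and nz: "a \<noteq> 0\<^sub>v n \<or> b \<noteq> 0\<^sub>v n"
    and Aa: "A *\<^sub>v a = Re \<mu> \<cdot>\<^sub>v a - Im \<mu> \<cdot>\<^sub>v b"
    and Ab: "A *\<^sub>v b = Im \<mu> \<cdot>\<^sub>v a + Re \<mu> \<cdot>\<^sub>v b"
    using complex_eigenvector_real_parts[OF A(1)] by metis
  have "Im \<mu> * (scalar_prod a a + scalar_prod b b) = 0"
    using scalar_prod_symmetric[OF A c] c comm_scalar_prod[OF c]
    by (simp add: Aa Ab scalar_prod_add_distrib[of _ n] scalar_prod_minus_distrib[of _ n] algebra_simps)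
  moreover have "scalar_prod a a + scalar_prod b b > 0"
    using nz scalar_prod_self_pos c scalar_prod_self_nonneg[of a] scalar_prod_self_nonneg[of b]
    by (metis add_nonneg_pos add_pos_nonneg)
  ultimately have im: "Im \<mu> = 0" by simp
  obtain u where u: "u \<in> carrier_vec n" "u \<noteq> 0\<^sub>v n" "A *\<^sub>v u = Re \<mu> \<cdot>\<^sub>v u"
  proof (cases "a = 0\<^sub>v n")
    case True
    have "Im \<mu> \<cdot>\<^sub>v a + Re \<mu> \<cdot>\<^sub>v b = Re \<mu> \<cdot>\<^sub>v b"
      using c im by (intro eq_vecI) auto
    then show thesis using that[of b] True nz c Ab by simp
  next
    case False
    have "Re \<mu> \<cdot>\<^sub>v a - Im \<mu> \<cdot>\<^sub>v b = Re \<mu> \<cdot>\<^sub>v a"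
      using c im by (intro eq_vecI) auto
    then show thesis using that[of a] False c Aa by simp
  qed
  define s where "s = 1 / sqrt (scalar_prod u u)"
  have "s * s * scalar_prod u u = 1"
    using scalar_prod_self_pos[OF u(1,2)] by (simp add: s_def)
  then have "scalar_prod (s \<cdot>\<^sub>v u) (s \<cdot>\<^sub>v u) = 1"
    using u by (simp add: mult.assoc)
  moreover have "A *\<^sub>v (s \<cdot>\<^sub>v u) = Re \<mu> \<cdot>\<^sub>v (s \<cdot>\<^sub>v u)"
    using u A by (simp add: mult_mat_vec[of _ n n] smult_smult_assoc mult.commute)
  ultimately show thesis
    using that[of "s \<cdot>\<^sub>v u"] u by simp
qed

section \<open>Square roots of positive semidefinite matrices\<close>

lemma mat_eqI_mult_vec:
  assumes A: "(A :: rmat) \<in> carrier_mat p q" and B: "B \<in> carrier_mat p q"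
    and eq: "\<And>x. x \<in> carrier_vec q \<Longrightarrow> A *\<^sub>v x = B *\<^sub>v x"
  shows "A = B"
proof (rule eq_matI)
  fix i j assume ij: "i < dim_row B" "j < dim_col B"
  then have "vec_index (A *\<^sub>v unit_vec q j) i = vec_index (B *\<^sub>v unit_vec q j) i"
    using eq[of "unit_vec q j"] by simp
  then show "A $$ (i, j) = B $$ (i, j)"
    using ij A B by simp
qed (use A B in auto)

text \<open>
  The Householder reflection in the hyperplane orthogonal to \<open>v - e\<^sub>0\<close> swaps the two unit
  vectors \<open>e\<^sub>0\<close> and \<open>v\<close>.  A reflection is convenient for a change of basis because it is its
  own inverse and its own transpose.
\<close>

lemma symmetric_involution_to_unit_vector:
  assumes v: "(v :: rvec) \<in> carrier_vec n" "scalar_prod v v = 1" and n: "0 < n"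
  obtains H where "H \<in> carrier_mat n n" "transpose_mat H = H" "H * H = 1\<^sub>m n" "H *\<^sub>v unit_vec n 0 = v"
proof -
  define w where "w = v - unit_vec n 0"
  define c where "c = scalar_prod w w"
  define H where "H = mat n n (\<lambda>(i, j). (if i = j then 1 else 0) - 2 / c * (vec_index w i * vec_index w j))"
  have w: "w \<in> carrier_vec n" using v by (simp add: w_def)
  have H: "H \<in> carrier_mat n n" "transpose_mat H = H"
    by (auto simp: H_def intro!: eq_matI)
  have Hx: "H *\<^sub>v x = x - (2 / c * scalar_prod w x) \<cdot>\<^sub>v w" if x: "x \<in> carrier_vec n" for x
  proof (intro eq_vecI)
    fix i assume "i < dim_vec (x - (2 / c * scalar_prod w x) \<cdot>\<^sub>v w)"
    then have i: "i < n" using w by simp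
    have "vec_index (H *\<^sub>v x) i = (\<Sum>j\<in>{0..<n}. ((if i = j then 1 else 0) - 2 / c * (vec_index w i * vec_index w j)) * vec_index x j)"
      using i x by (simp add: H_def scalar_prod_def)
    also have "\<dots> = (\<Sum>j\<in>{0..<n}. (if i = j then vec_index x j else 0))
        - (2 / c * (\<Sum>j\<in>{0..<n}. vec_index w j * vec_index x j)) * vec_index w i"
      unfolding sum_distrib_left sum_distrib_right sum_subtractf[symmetric]
      by (intro sum.cong refl) (auto simp: algebra_simps)
    also have "\<dots> = vec_index (x - (2 / c * scalar_prod w x) \<cdot>\<^sub>v w) i"
      using i x w by (simp add: scalar_prod_def)
    finally show "vec_index (H *\<^sub>v x) i = vec_index (x - (2 / c * scalar_prod w x) \<cdot>\<^sub>v w) i" .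
  qed (use w x in \<open>simp add: H_def\<close>)
  \<comment> \<open>If \<open>v = e\<^sub>0\<close>, then \<open>w = 0\<close> and \<open>2 / c = 0\<close>, so that \<open>H\<close> is the identity.\<close>
  have ww: "c \<noteq> 0 \<or> w = 0\<^sub>v n"
    using scalar_prod_self_pos[OF w] unfolding c_def by (metis less_irrefl)
  have "H * H = 1\<^sub>m n"
  proof (rule mat_eqI_mult_vec[of _ n n])
    fix x :: rvec assume x: "x \<in> carrier_vec n"
    let ?y = "x - (2 / c * scalar_prod w x) \<cdot>\<^sub>v w"
    have y: "?y \<in> carrier_vec n" using x w by simp
    have "2 / c * scalar_prod w ?y = - (2 / c * scalar_prod w x)"
      using x w ww by (auto simp: scalar_prod_minus_distrib[of _ n] c_def[symmetric] field_simps)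
    then have "H *\<^sub>v ?y = ?y - (- (2 / c * scalar_prod w x)) \<cdot>\<^sub>v w"
      using Hx[OF y] by metis
    also have "\<dots> = x"
      using x w by (intro eq_vecI) auto
    finally have "H *\<^sub>v (H *\<^sub>v x) = x"
      using Hx[OF x] by simp
    then show "H * H *\<^sub>v x = 1\<^sub>m n *\<^sub>v x"
      using H x by (simp add: assoc_mult_mat_vec[of _ n n _ n])
  qed (use H in auto)
  moreover have "H *\<^sub>v unit_vec n 0 = v"
  proof (cases "w = 0\<^sub>v n")
    case True
    have "v = unit_vec n 0"
    proof (intro eq_vecI)
      fix i assume "i < dim_vec (unit_vec n 0 :: rvec)"
      then show "vec_index v i = vec_index (unit_vec n 0) i"
        using arg_cong[OF True, of "\<lambda>u. vec_index u i"] v by (simp add: w_def)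
    qed (use v in auto)
    moreover have "H *\<^sub>v unit_vec n 0 = unit_vec n 0"
      using Hx[of "unit_vec n 0"] True by (auto intro!: eq_vecI)
    ultimately show ?thesis by simp
  next
    case False
    have "c = 2 - 2 * vec_index v 0" "scalar_prod w (unit_vec n 0) = vec_index v 0 - 1"
      using v n by (simp_all add: c_def w_def scalar_prod_minus_distrib[of _ n] minus_scalar_prod_distrib[of _ n])
    moreover have "c \<noteq> 0" using ww False by simp
    ultimately have "2 / c * scalar_prod w (unit_vec n 0) = -1"
      by (simp add: field_simps)
    then have "H *\<^sub>v unit_vec n 0 = unit_vec n 0 - (-1) \<cdot>\<^sub>v w"
      using Hx[of "unit_vec n 0"] by (metis unit_vec_carrier)
    also have "\<dots> = v"
      using v by (intro eq_vecI) (auto simp: w_def)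
    finally show ?thesis .
  qed
  ultimately show thesis
    using that H by blast
qed

text \<open>
  Induction on the dimension.  A reflection \<open>H\<close> taking \<open>e\<^sub>0\<close> to a unit eigenvector turns \<open>A\<close>
  into \<open>B = H A H\<close> with first column \<open>e e\<^sub>0\<close>; by symmetry \<open>B\<close> is block diagonal with blocks \<open>e\<close>
  and \<open>D\<close>.  Take \<open>\<surd>e\<close> and, by induction, a root of \<open>D\<close>, and conjugate back with \<open>H\<close>.
\<close>

lemma pos_semidef_square_root_exists:
  assumes "pos_semidef n A"
  shows "\<exists>S. pos_semidef n S \<and> S * S = A"
  using assms
proof (induction n arbitrary: A)
  case 0
  then have "A * A = A"
    by (intro eq_matI) (auto simp: pos_semidef_def)
  with 0 show ?case by blast
next
  case (Suc n A)
  have A: "A \<in> carrier_mat (Suc n) (Suc n)" "transpose_mat A = A"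
    using Suc.prems by (auto simp: pos_semidef_def)
  obtain e v where v: "v \<in> carrier_vec (Suc n)" "scalar_prod v v = 1" "A *\<^sub>v v = e \<cdot>\<^sub>v v"
    using symmetric_real_eigenvector[OF A zero_less_Suc] by blast
  have e: "0 \<le> e"
    using Suc.prems v by (auto simp: pos_semidef_def dest!: bspec[of _ _ v])
  obtain H where H: "H \<in> carrier_mat (Suc n) (Suc n)" "transpose_mat H = H" "H * H = 1\<^sub>m (Suc n)"
    and Hv: "H *\<^sub>v unit_vec (Suc n) 0 = v"
    using symmetric_involution_to_unit_vector[OF v(1,2) zero_less_Suc] by blast
  define B where "B = H * A * H"
  have B: "B \<in> carrier_mat (Suc n) (Suc n)"
    using A H by (simp add: B_def)
  have psdB: "pos_semidef (Suc n) B"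
    using pos_semidef_congruence[OF Suc.prems H(1)] H(2) by (simp add: B_def)
  then have symB: "transpose_mat B = B"
    by (simp add: pos_semidef_def)
  have "B *\<^sub>v unit_vec (Suc n) 0 = H *\<^sub>v (A *\<^sub>v v)"
    using A H by (simp add: B_def Hv assoc_mult_mat_vec[of _ "Suc n" "Suc n" _ "Suc n"])
  also have "\<dots> = e \<cdot>\<^sub>v (H *\<^sub>v v)"
    using v H by (simp add: mult_mat_vec[of _ "Suc n" "Suc n"])
  also have "H *\<^sub>v v = (H * H) *\<^sub>v unit_vec (Suc n) 0"
    unfolding Hv[symmetric] by (rule assoc_mult_mat_vec[OF H(1) H(1) unit_vec_carrier, symmetric])
  also have "\<dots> = unit_vec (Suc n) 0"
    by (simp add: H(3))
  finally have Be: "B *\<^sub>v unit_vec (Suc n) 0 = e \<cdot>\<^sub>v unit_vec (Suc n) 0" .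
  have col0: "B $$ (i, 0) = (if i = 0 then e else 0)" if "i < Suc n" for i
    using arg_cong[OF Be, of "\<lambda>u. vec_index u i"] that B by (auto split: if_splits)
  have row0: "B $$ (0, i) = (if i = 0 then e else 0)" if "i < Suc n" for i
    using col0[OF that] arg_cong[OF symB, of "\<lambda>M. M $$ (i, 0)"] that B by simp
  define D where "D = mat n n (\<lambda>(i, j). B $$ (Suc i, Suc j))"
  have D: "D \<in> carrier_mat n n" by (simp add: D_def)
  have B_block: "B = four_block_mat (mat 1 1 (\<lambda>_. e)) (0\<^sub>m 1 n) (0\<^sub>m n 1) D"
    using B col0 row0 by (intro eq_matI) (auto simp: D_def)
  have "pos_semidef n D"
    unfolding pos_semidef_def
  proof (intro conjI ballI D)
    show "transpose_mat D = D"
    proof (rule eq_matI)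
      fix i j assume "i < dim_row D" "j < dim_col D"
      then show "transpose_mat D $$ (i, j) = D $$ (i, j)"
        using arg_cong[OF symB, of "\<lambda>M. M $$ (Suc i, Suc j)"] B by (simp add: D_def)
    qed (simp_all add: D_def)
    fix x :: rvec assume x: "x \<in> carrier_vec n"
    have "0 \<le> scalar_prod (0\<^sub>v 1 @\<^sub>v x) (B *\<^sub>v (0\<^sub>v 1 @\<^sub>v x))"
      using psdB append_carrier_vec[OF zero_carrier_vec[of 1] x] by (simp add: pos_semidef_def del: One_nat_def flip: plus_1_eq_Suc)
    also have "\<dots> = scalar_prod x (D *\<^sub>v x)"
      unfolding B_block using D x by (subst scalar_prod_four_block_diag[of _ 1 _ n]) (auto simp: scalar_prod_def)
    finally show "0 \<le> scalar_prod x (D *\<^sub>v x)" .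
  qed
  from Suc.IH[OF this] obtain S where S: "pos_semidef n S" "S * S = D" by blast
  have S': "S \<in> carrier_mat n n" using S by (simp add: pos_semidef_def)
  define E where "E = mat 1 1 (\<lambda>_. sqrt e)"
  define T where "T = four_block_mat E (0\<^sub>m 1 n) (0\<^sub>m n 1) S"
  have "0 \<le> u * (sqrt e * u)" for u
    using e by (simp add: mult.left_commute[of u])
  then have E: "pos_semidef 1 E" "E * E = mat 1 1 (\<lambda>_. e)"
    using e by (auto simp: E_def pos_semidef_def scalar_prod_def intro!: eq_matI)
  have E': "E \<in> carrier_mat 1 1" by (simp add: E_def)
  have T: "pos_semidef (Suc n) T"
    using pos_semidef_four_block_diag[OF E(1) S(1)] by (simp add: T_def)
  have T': "T \<in> carrier_mat (Suc n) (Suc n)" using T by (simp add: pos_semidef_def)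
  have TT: "T * T = B"
    unfolding T_def B_block
    by (subst mult_four_block_mat[of _ 1 1 _ n _ n _ _ 1 _ n])
       (use E' S' D E S in auto)
  define R where "R = H * T * H"
  have "pos_semidef (Suc n) R"
    using pos_semidef_congruence[OF T H(1)] H(2) by (simp add: R_def)
  moreover have "R * R = A"
  proof (rule mat_eqI_mult_vec[of _ "Suc n" "Suc n"])
    fix x :: rvec assume x: "x \<in> carrier_vec (Suc n)"
    note [simp] = assoc_mult_mat_vec[of _ "Suc n" "Suc n" _ "Suc n"]
    have HH: "H *\<^sub>v (H *\<^sub>v y) = y" if "y \<in> carrier_vec (Suc n)" for y
      using assoc_mult_mat_vec[OF H(1) H(1) that] H(3) that by simp
    have "R * R *\<^sub>v x = H *\<^sub>v ((T * T) *\<^sub>v (H *\<^sub>v x))"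
      using H T' x by (simp add: R_def HH)
    also have "\<dots> = A *\<^sub>v x"
      using H A x by (simp add: TT B_def HH)
    finally show "R * R *\<^sub>v x = A *\<^sub>v x" .
  qed (use A H T' in \<open>auto simp: R_def\<close>)
  ultimately show ?case by blast
qed

lemma mat_sqrt_properties:
  assumes "pos_semidef n A"
  shows "pos_semidef n (mat_sqrt A)" "mat_sqrt A * mat_sqrt A = A"
proof -
  have "dim_row A = n" using assms by (auto simp: pos_semidef_def)
  then have "pos_semidef n (mat_sqrt A) \<and> mat_sqrt A * mat_sqrt A = A"
    unfolding mat_sqrt_def using someI_ex[OF pos_semidef_square_root_exists[OF assms]] by simp
  then show "pos_semidef n (mat_sqrt A)" "mat_sqrt A * mat_sqrt A = A" by auto
qed

section \<open>Linear differential equations and the integral of a dissipated quantity\<close>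

text \<open>
  The solution is \<open>exp(t M) z\<close>.  It is built componentwise as the real power series with
  coefficients \<open>(M\<^sup>j z)\<^sub>k / j!\<close>, which converges everywhere because \<open>(M\<^sup>j z)\<^sub>k\<close> grows at most
  geometrically in \<open>j\<close>; termwise differentiation shifts \<open>j\<close> by one, that is, multiplies by \<open>M\<close>.
\<close>

lemma linear_ode_solution_exists:
  assumes M: "(M :: rmat) \<in> carrier_mat n n" and z: "z \<in> carrier_vec n"
  shows "\<exists>x. solves_linear_ode M z x"
proof -
  define y where "y j = ((*\<^sub>v) M ^^ j) z" for j
  define c where "c k j = vec_index (y j) k / fact j" for k j
  define x where "x t = Matrix.vec n (\<lambda>k. \<Sum>j. c k j * t ^ j)" for t :: real
  have y: "y j \<in> carrier_vec n" for j
    unfolding y_def using M z by (induction j) auto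
  have y_Suc: "vec_index (y (Suc j)) k = (\<Sum>l\<in>{0..<n}. M $$ (k, l) * vec_index (y j) l)" if "k < n" for k j
    using that M y[of j] by (simp add: y_def scalar_prod_def)
  define K where "K = (\<Sum>k\<in>{0..<n}. \<Sum>l\<in>{0..<n}. \<bar>M $$ (k, l)\<bar>)"
  define L where "L = (\<Sum>k\<in>{0..<n}. \<bar>vec_index z k\<bar>)"
  have K0: "0 \<le> K" and L0: "0 \<le> L" by (auto simp: K_def L_def intro!: sum_nonneg)
  have bound: "\<bar>vec_index (y j) k\<bar> \<le> K ^ j * L" if "k < n" for j k
    using that
  proof (induction j arbitrary: k)
    case 0
    then show ?case
      by (auto simp: y_def L_def intro!: member_le_sum)
  next
    case (Suc j)
    have "\<bar>vec_index (y (Suc j)) k\<bar> \<le> (\<Sum>l\<in>{0..<n}. \<bar>M $$ (k, l)\<bar> * (K ^ j * L))"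
      unfolding y_Suc[OF Suc.prems]
      by (rule order_trans[OF sum_abs]) (auto simp: abs_mult intro!: sum_mono mult_left_mono Suc.IH)
    also have "\<dots> = (\<Sum>l\<in>{0..<n}. \<bar>M $$ (k, l)\<bar>) * (K ^ j * L)"
      by (simp add: sum_distrib_right)
    also have "\<dots> \<le> K * (K ^ j * L)"
      unfolding K_def using Suc.prems K0 L0
      by (intro mult_right_mono member_le_sum[where f = "\<lambda>k. \<Sum>l\<in>{0..<n}. \<bar>M $$ (k, l)\<bar>"])
         (auto simp: K_def intro!: sum_nonneg)
    finally show ?case by simp
  qed
  have summable: "summable (\<lambda>j. c k j * t ^ j)" if k: "k < n" for k t
  proof (rule summable_comparison_test')
    show "summable (\<lambda>j. L * (inverse (fact j) * (K * \<bar>t\<bar>) ^ j))"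
      by (intro summable_mult summable_exp)
    show "norm (c k j * t ^ j) \<le> L * (inverse (fact j) * (K * \<bar>t\<bar>) ^ j)" for j
      using mult_right_mono[OF bound[OF k, of j], of "\<bar>t\<bar> ^ j / fact j"]
      by (simp add: c_def abs_mult power_abs power_mult_distrib field_simps)
  qed
  have deriv: "((\<lambda>\<tau>. vec_index (x \<tau>) k) has_real_derivative vec_index (M *\<^sub>v x t) k) (at t)"
    if k: "k < n" for k t
  proof -
    have "diffs (c k) j * t ^ j = (\<Sum>l\<in>{0..<n}. M $$ (k, l) * (c l j * t ^ j))" for j
    proof -
      have "diffs (c k) j = vec_index (y (Suc j)) k / fact j"
        by (simp add: diffs_def c_def field_simps del: of_nat_Suc)
      then show ?thesis
        by (simp add: y_Suc[OF k] c_def sum_distrib_left sum_distrib_right sum_divide_distrib mult_ac)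
    qed
    then have "(\<Sum>j. diffs (c k) j * t ^ j) = (\<Sum>l\<in>{0..<n}. \<Sum>j. M $$ (k, l) * (c l j * t ^ j))"
      by (simp only:) (intro suminf_sum summable_mult summable, simp)
    also have "\<dots> = (\<Sum>l\<in>{0..<n}. M $$ (k, l) * (\<Sum>j. c l j * t ^ j))"
      by (intro sum.cong refl suminf_mult summable) simp
    also have "\<dots> = vec_index (M *\<^sub>v x t) k"
      using k M by (simp add: x_def scalar_prod_def)
    finally show ?thesis
      using termdiffs_strong_converges_everywhere[of "c k" t, OF summable[OF k]] k
      by (simp add: x_def)
  qed
  have "x 0 = z"
  proof (intro eq_vecI)
    fix k assume "k < dim_vec z"
    then have "vec_index (x 0) k = (\<Sum>j. c k j * 0 ^ j)"
      using z by (simp add: x_def)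
    also have "\<dots> = vec_index z k"
      using powser_zero[of "c k"] by (simp add: c_def y_def)
    finally show "vec_index (x 0) k = vec_index z k" .
  qed (use z in \<open>simp add: x_def\<close>)
  then have "solves_linear_ode M z x"
    using M deriv by (auto simp: solves_linear_ode_def x_def intro: has_field_derivative_at_within)
  then show ?thesis by blast
qed

text \<open>
  On \<open>[0, k]\<close> the integral of \<open>f\<close> is at most \<open>V 0 - V k \<le> V 0\<close>; let \<open>k\<close> tend to infinity by
  monotone convergence.  The derivative at \<open>0\<close> is one-sided.
\<close>

lemma nn_integral_le_of_nonneg_storage:
  fixes f V V' :: "real \<Rightarrow> real"
  assumes V: "\<And>t. 0 \<le> t \<Longrightarrow> (V has_real_derivative V' t) (at t within {0..})"
    and V0: "\<And>t. 0 \<le> t \<Longrightarrow> 0 \<le> V t"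
    and f0: "\<And>t. 0 \<le> t \<Longrightarrow> 0 \<le> f t"
    and f: "\<And>t. 0 \<le> t \<Longrightarrow> f t \<le> - V' t"
    and cont: "continuous_on {0..} f"
  shows "(\<integral>\<^sup>+t\<in>{0..}. ennreal (f t) \<partial>lborel) \<le> ennreal (V 0)"
proof -
  define g where "g k t = ennreal (f t) * indicator {0..real k} t" for k t
  have meas: "(\<lambda>t. ennreal (f t) * indicator A t) \<in> borel_measurable lborel"
    if "A \<subseteq> {0..}" "A \<in> sets borel" for A
  proof -
    have "(\<lambda>t. indicator A t *\<^sub>R f t) \<in> borel_measurable borel"
      using that cont by (intro borel_measurable_continuous_on_indicator continuous_on_subset[OF cont])
    then have "(\<lambda>t. ennreal (indicator A t *\<^sub>R f t)) \<in> borel_measurable lborel"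
      by simp
    also have "(\<lambda>t. ennreal (indicator A t *\<^sub>R f t)) = (\<lambda>t. ennreal (f t) * indicator A t)"
      by (auto simp: fun_eq_iff split: split_indicator)
    finally show ?thesis .
  qed
  have le: "integral\<^sup>N lborel (g k) \<le> ennreal (V 0)" for k
  proof -
    have "((\<lambda>t. - V' t) has_integral - V (real k) - - V 0) {0..real k}"
      by (intro fundamental_theorem_of_calculus)
         (auto simp: has_real_derivative_iff_has_vector_derivative[symmetric]
           intro!: derivative_eq_intros has_field_derivative_subset[OF V])
    then have "(\<integral>\<^sup>+t. ennreal (- V' t) * indicator {0..real k} t \<partial>lborel) = ennreal (- V (real k) - - V 0)"
      using order_trans[OF f0 f] by (intro nn_integral_has_integral_lebesgue') auto
    moreover have "integral\<^sup>N lborel (g k) \<le> (\<integral>\<^sup>+t. ennreal (- V' t) * indicator {0..real k} t \<partial>lborel)"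
      using f by (intro nn_integral_mono) (auto simp: g_def intro: ennreal_leI split: split_indicator)
    ultimately show ?thesis
      using V0[of "real k"] ennreal_leI[of "V 0 - V (real k)" "V 0"] by (simp add: order_trans)
  qed
  have "(SUP k. g k t) = ennreal (f t) * indicator {0..} t" for t
  proof (cases "0 \<le> t")
    case True
    obtain m where m: "t \<le> real m" using real_arch_simple by blast
    show ?thesis
    proof (rule antisym)
      show "(SUP k. g k t) \<le> ennreal (f t) * indicator {0..} t"
        by (rule SUP_least) (auto simp: g_def split: split_indicator)
      have eq: "ennreal (f t) * indicator {0..} t = g m t"
        using True m by (simp add: g_def)
      show "ennreal (f t) * indicator {0..} t \<le> (SUP k. g k t)"
        unfolding eq by (rule SUP_upper) simp
    qed
  qed (simp add: g_def)
  then have "(\<integral>\<^sup>+t\<in>{0..}. ennreal (f t) \<partial>lborel) = (\<integral>\<^sup>+t. (SUP k. g k t) \<partial>lborel)"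
    by simp
  also have "\<dots> = (SUP k. integral\<^sup>N lborel (g k))"
  proof (rule nn_integral_monotone_convergence_SUP)
    show "incseq g"
      by (auto simp: incseq_def le_fun_def g_def split: split_indicator)
    show "g k \<in> borel_measurable lborel" for k
      unfolding g_def by (rule meas) auto
  qed
  also have "\<dots> \<le> ennreal (V 0)"
    by (rule SUP_least) (rule le)
  finally show ?thesis .
qed

text \<open>
  Stated for derivatives within \<open>T\<close>, since outside \<open>T\<close> the dimension of \<open>x\<close> is arbitrary and the
  quadratic form need not equal its expression in components.
\<close>

lemma has_derivative_quadratic_form:
  fixes P :: rmat and x :: "real \<Rightarrow> rvec"
  assumes P: "P \<in> carrier_mat n n" "transpose_mat P = P"
    and x: "\<And>\<tau>. \<tau> \<in> T \<Longrightarrow> x \<tau> \<in> carrier_vec n" and t: "t \<in> T" and y: "y \<in> carrier_vec n"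
    and d: "\<And>k. k < n \<Longrightarrow> ((\<lambda>\<tau>. vec_index (x \<tau>) k) has_real_derivative vec_index y k) (at t within T)"
  shows "((\<lambda>\<tau>. scalar_prod (x \<tau>) (P *\<^sub>v x \<tau>)) has_real_derivative
    2 * scalar_prod (x t) (P *\<^sub>v y)) (at t within T)"
proof -
  let ?q = "\<lambda>u v. \<Sum>i\<in>{0..<n}. vec_index u i * (\<Sum>j\<in>{0..<n}. P $$ (i, j) * vec_index v j)"
  have q: "scalar_prod u (P *\<^sub>v v) = ?q u v" if "u \<in> carrier_vec n" "v \<in> carrier_vec n" for u v
    using that P by (simp add: scalar_prod_def)
  have "((\<lambda>\<tau>. ?q (x \<tau>) (x \<tau>)) has_real_derivative ?q y (x t) + ?q (x t) y) (at t within T)"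
    by (rule derivative_eq_intros refl d | simp)+
       (simp add: sum.distrib[symmetric] algebra_simps)
  moreover have "?q y (x t) + ?q (x t) y = 2 * scalar_prod (x t) (P *\<^sub>v y)"
    using scalar_prod_symmetric[OF P y x[OF t]] x[OF t] y by (simp add: q)
  ultimately have "((\<lambda>\<tau>. ?q (x \<tau>) (x \<tau>)) has_real_derivative 2 * scalar_prod (x t) (P *\<^sub>v y)) (at t within T)"
    by simp
  then show ?thesis
    by (rule has_field_derivative_transform_within[where d = 1]) (use x t q in auto)
qed

lemma continuous_on_mult_mat_vec:
  fixes A :: rmat and x :: "real \<Rightarrow> rvec"
  assumes A: "A \<in> carrier_mat m n" and i: "i < m"
    and x: "\<And>t. t \<in> T \<Longrightarrow> x t \<in> carrier_vec n"
    and c: "\<And>k. k < n \<Longrightarrow> continuous_on T (\<lambda>t. vec_index (x t) k)"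
  shows "continuous_on T (\<lambda>t. vec_index (A *\<^sub>v x t) i)"
proof -
  have "continuous_on T (\<lambda>t. \<Sum>j\<in>{0..<n}. A $$ (i, j) * vec_index (x t) j)"
    by (intro continuous_intros c) auto
  then show ?thesis
    by (rule continuous_on_eq) (use A i carrier_vecD[OF x] in \<open>auto simp: scalar_prod_def\<close>)
qed

lemma continuous_on_quadratic_form:
  fixes A :: rmat and x :: "real \<Rightarrow> rvec"
  assumes A: "A \<in> carrier_mat n n"
    and x: "\<And>t. t \<in> T \<Longrightarrow> x t \<in> carrier_vec n"
    and c: "\<And>k. k < n \<Longrightarrow> continuous_on T (\<lambda>t. vec_index (x t) k)"
  shows "continuous_on T (\<lambda>t. scalar_prod (x t) (A *\<^sub>v x t))"
proof -
  have "continuous_on T (\<lambda>t. \<Sum>i\<in>{0..<n}. vec_index (x t) i * vec_index (A *\<^sub>v x t) i)"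
    by (intro continuous_intros c continuous_on_mult_mat_vec[OF A _ x c]) auto
  then show ?thesis
    by (rule continuous_on_eq) (use A x in \<open>auto simp: scalar_prod_def\<close>)
qed

section \<open>Block matrices and test vectors\<close>

lemma block_row_singleton: "block_row (dim_row M) [M] = M"
  by (simp add: block_row_def)

lemma block_col_singleton: "block_col (dim_col M) [M] = M"
  by (simp add: block_col_def)

lemma dim_block_row: "dim_row (block_row d Ms) = d" "dim_col (block_row d Ms) = sum_list (map dim_col Ms)"
  by (simp_all add: block_row_def length_concat comp_def)

lemma dim_block_col: "dim_col (block_col d Ms) = d" "dim_row (block_col d Ms) = sum_list (map dim_row Ms)"
  by (simp_all add: block_col_def length_concat comp_def)

lemma block_row_Cons_mult_vec:
  assumes M: "(M :: rmat) \<in> carrier_mat d p" and Ms: "block_row d Ms \<in> carrier_mat d q"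
    and x: "x \<in> carrier_vec p" and y: "y \<in> carrier_vec q"
  shows "block_row d (M # Ms) *\<^sub>v (x @\<^sub>v y) = M *\<^sub>v x + block_row d Ms *\<^sub>v y"
proof (rule eq_vecI)
  have len: "length (concat (map cols Ms)) = q"
    using Ms unfolding block_row_def by (metis carrier_matD(2) mat_of_cols_carrier(3))
  fix i assume "i < dim_vec (M *\<^sub>v x + block_row d Ms *\<^sub>v y)"
  then have i: "i < d" using Ms by simp
  have "Matrix.row (block_row d (M # Ms)) i = Matrix.row M i @\<^sub>v Matrix.row (block_row d Ms) i"
    using M i len by (intro eq_vecI) (auto simp: block_row_def mat_of_cols_index nth_append)
  then show "vec_index (block_row d (M # Ms) *\<^sub>v (x @\<^sub>v y)) i = vec_index (M *\<^sub>v x + block_row d Ms *\<^sub>v y) i"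
    using M Ms x y i by (simp add: dim_block_row scalar_prod_append[of _ p _ q])
qed (use Ms in \<open>simp add: dim_block_row\<close>)

lemma block_col_Cons_mult_vec:
  assumes M: "(M :: rmat) \<in> carrier_mat p d" and Ms: "block_col d Ms \<in> carrier_mat q d"
    and x: "x \<in> carrier_vec d"
  shows "block_col d (M # Ms) *\<^sub>v x = (M *\<^sub>v x) @\<^sub>v (block_col d Ms *\<^sub>v x)"
proof (rule eq_vecI)
  have len: "length (concat (map rows Ms)) = q"
    using Ms unfolding block_col_def by (metis carrier_matD(1) mat_of_rows_carrier(2))
  fix i assume "i < dim_vec ((M *\<^sub>v x) @\<^sub>v (block_col d Ms *\<^sub>v x))"
  then have i: "i < p + q" using M Ms by simp
  have "Matrix.row (block_col d (M # Ms)) i = (if i < p then Matrix.row M i else Matrix.row (block_col d Ms) (i - p))"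
    using M i len by (intro eq_vecI) (auto simp: block_col_def mat_of_rows_index nth_append)
  then show "vec_index (block_col d (M # Ms) *\<^sub>v x) i = vec_index ((M *\<^sub>v x) @\<^sub>v (block_col d Ms *\<^sub>v x)) i"
    using M Ms i by (auto simp: dim_block_col)
qed (use M Ms in \<open>simp add: dim_block_col\<close>)

lemma block_row_3_mult_vec:
  assumes "A1 \<in> carrier_mat d p1" "A2 \<in> carrier_mat d p2" "(A3 :: rmat) \<in> carrier_mat d p3"
    and "x1 \<in> carrier_vec p1" "x2 \<in> carrier_vec p2" "x3 \<in> carrier_vec p3"
  shows "block_row d [A1, A2, A3] *\<^sub>v (x1 @\<^sub>v (x2 @\<^sub>v x3)) = A1 *\<^sub>v x1 + (A2 *\<^sub>v x2 + A3 *\<^sub>v x3)"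
proof -
  have 3: "block_row d [A3] = A3"
    using block_row_singleton[of A3] assms by simp
  have "block_row d [A2, A3] \<in> carrier_mat d (p2 + p3)"
    using assms by (intro carrier_matI) (simp_all add: dim_block_row)
  then show ?thesis
    using assms by (simp add: 3 block_row_Cons_mult_vec[of _ _ p1 _ "p2 + p3"] block_row_Cons_mult_vec[of _ _ p2 _ p3])
qed

lemma block_col_3_mult_vec:
  assumes "A1 \<in> carrier_mat p1 d" "A2 \<in> carrier_mat p2 d" "(A3 :: rmat) \<in> carrier_mat p3 d"
    and "x \<in> carrier_vec d"
  shows "block_col d [A1, A2, A3] *\<^sub>v x = (A1 *\<^sub>v x) @\<^sub>v ((A2 *\<^sub>v x) @\<^sub>v (A3 *\<^sub>v x))"
proof -
  have 3: "block_col d [A3] = A3"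
    using block_col_singleton[of A3] assms by simp
  have "block_col d [A2, A3] \<in> carrier_mat (p2 + p3) d"
    using assms by (intro carrier_matI) (simp_all add: dim_block_col)
  then show ?thesis
    using assms by (simp add: 3 block_col_Cons_mult_vec[of _ p1 _ _ "p2 + p3"] block_col_Cons_mult_vec[of _ p2 _ _ p3])
qed

text \<open>
  At \<open>(v, S v, K v)\<close> the last two block rows vanish, and the off-diagonal blocks of the first row
  contribute \<open>|S v|\<^sup>2 + |K v|\<^sup>2\<close>.  These values of the last two components maximise the form for
  given \<open>v\<close>, so nothing is lost.
\<close>

lemma neg_def_block_imp_quadratic_bound:
  assumes neg: "neg_def (n + p + m)
       (block_col (n + p + m)
         [block_row n [L, transpose_mat S, transpose_mat K],
          block_row p [S, - 1\<^sub>m p, 0\<^sub>m p m],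
          block_row m [K, 0\<^sub>m m p, - 1\<^sub>m m]])"
    and L: "L \<in> carrier_mat n n" and S: "S \<in> carrier_mat p n" and K: "K \<in> carrier_mat m n"
    and v: "v \<in> carrier_vec n" "v \<noteq> 0\<^sub>v n"
  shows "scalar_prod v (L *\<^sub>v v) + scalar_prod (S *\<^sub>v v) (S *\<^sub>v v) + scalar_prod (K *\<^sub>v v) (K *\<^sub>v v) < 0"
proof -
  let ?R1 = "block_row n [L, transpose_mat S, transpose_mat K]"
  let ?R2 = "block_row p [S, - 1\<^sub>m p, 0\<^sub>m p m]"
  let ?R3 = "block_row m [K, 0\<^sub>m m p, - 1\<^sub>m m]"
  let ?y = "S *\<^sub>v v" and ?u = "K *\<^sub>v v"
  let ?w = "v @\<^sub>v (?y @\<^sub>v ?u)"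
  have y: "?y \<in> carrier_vec p" and u: "?u \<in> carrier_vec m"
    using S K v by auto
  have w: "?w \<in> carrier_vec (n + p + m)"
    using v y u by (simp add: add.assoc)
  have R: "?R1 \<in> carrier_mat n (n + p + m)" "?R2 \<in> carrier_mat p (n + p + m)" "?R3 \<in> carrier_mat m (n + p + m)"
    using L S K by (auto intro!: carrier_matI simp: dim_block_row)
  have neg1: "(- 1\<^sub>m k) *\<^sub>v x = - x" if "x \<in> carrier_vec k" for k and x :: rvec
    using that by (intro eq_vecI) auto
  have zero: "0\<^sub>m k l *\<^sub>v x = 0\<^sub>v k" if "x \<in> carrier_vec l" for k l and x :: rvec
    using that by (intro eq_vecI) auto
  have "?R1 *\<^sub>v ?w = L *\<^sub>v v + (transpose_mat S *\<^sub>v ?y + transpose_mat K *\<^sub>v ?u)"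
    using L S K v y u by (intro block_row_3_mult_vec) auto
  moreover have "?R2 *\<^sub>v ?w = 0\<^sub>v p"
    using S K v y u by (subst block_row_3_mult_vec[of _ _ n _ p _ m]) (auto simp: neg1 zero)
  moreover have "?R3 *\<^sub>v ?w = 0\<^sub>v m"
    using S K v y u by (subst block_row_3_mult_vec[of _ _ n _ p _ m]) (auto simp: neg1 zero)
  ultimately have "block_col (n + p + m) [?R1, ?R2, ?R3] *\<^sub>v ?w =
      (L *\<^sub>v v + (transpose_mat S *\<^sub>v ?y + transpose_mat K *\<^sub>v ?u)) @\<^sub>v (0\<^sub>v p @\<^sub>v 0\<^sub>v m)"
    using block_col_3_mult_vec[OF R w] by simp
  then have "scalar_prod ?w (block_col (n + p + m) [?R1, ?R2, ?R3] *\<^sub>v ?w) =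
      scalar_prod v (L *\<^sub>v v) + (scalar_prod v (transpose_mat S *\<^sub>v ?y) + scalar_prod v (transpose_mat K *\<^sub>v ?u))"
    using L S K v y u
    by (simp add: scalar_prod_append[of _ n _ "p + m"] scalar_prod_append[of _ p _ m] scalar_prod_add_distrib[of _ n])
  also have "scalar_prod v (transpose_mat S *\<^sub>v ?y) = scalar_prod ?y ?y"
    using scalar_prod_transpose_mult[of "transpose_mat S" n p v ?y] S v y by simp
  also have "scalar_prod v (transpose_mat K *\<^sub>v ?u) = scalar_prod ?u ?u"
    using scalar_prod_transpose_mult[of "transpose_mat K" n m v ?u] K v u by simp
  finally have "scalar_prod ?w (block_col (n + p + m) [?R1, ?R2, ?R3] *\<^sub>v ?w) =
      scalar_prod v (L *\<^sub>v v) + (scalar_prod ?y ?y + scalar_prod ?u ?u)" .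
  moreover have "?w \<noteq> 0\<^sub>v (n + p + m)"
  proof
    assume "?w = 0\<^sub>v (n + p + m)"
    then have "vec_index ?w i = 0" if "i < n" for i
      using that by simp
    then have "v = 0\<^sub>v n"
      using v by (intro eq_vecI) auto
    with v show False by simp
  qed
  ultimately show ?thesis
    using neg w by (auto simp: neg_def_def)
qed

lemma mat_inv_pos_def:
  assumes "pos_def n P"
  shows "mat_inv P \<in> carrier_mat n n" "mat_inv P * P = 1\<^sub>m n"
proof -
  have P: "P \<in> carrier_mat n n" using assms by (simp add: pos_def_def)
  have "Determinant.det P \<noteq> 0"
  proof
    assume "Determinant.det P = 0"
    then obtain v where "v \<in> carrier_vec n" "v \<noteq> 0\<^sub>v n" "P *\<^sub>v v = 0\<^sub>v n"
      using det_0_iff_vec_prod_zero[OF P] by blast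
    then show False
      using assms by (auto simp: pos_def_def)
  qed
  then have "P \<in> Units (ring_mat TYPE(real) n ())"
    using det_non_zero_imp_unit[OF P] by simp
  then obtain Y where "mat_inverse P = Some Y"
    using mat_inverse(1)[OF P, of "()"] by (cases "mat_inverse P") auto
  then show "mat_inv P \<in> carrier_mat n n" "mat_inv P * P = 1\<^sub>m n"
    using mat_inverse(2)[OF P] by (auto simp: mat_inv_def)
qed

text \<open>
  At \<open>(1, -P z)\<close> the lower block row gives \<open>z - P\<^sup>-\<^sup>1 P z = 0\<close>, and the upper one gives the
  Schur complement \<open>\<delta> - z' P z\<close>.
\<close>

lemma pos_def_bordered_inverse_imp_bound:
  assumes P: "pos_def n P" and z: "z \<in> carrier_vec n"
    and pd: "pos_def (1 + n) (four_block_mat (mat 1 1 (\<lambda>_. \<delta>)) (mat_of_row z) (mat_of_cols n [z]) (mat_inv P))"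
  shows "scalar_prod z (P *\<^sub>v z) < \<delta>"
proof -
  let ?Y = "mat_inv P"
  let ?M = "four_block_mat (mat 1 1 (\<lambda>_. \<delta>)) (mat_of_row z) (mat_of_cols n [z]) ?Y"
  define e where "e = Matrix.vec 1 (\<lambda>_. 1 :: real)"
  define y where "y = (- 1) \<cdot>\<^sub>v (P *\<^sub>v z)"
  have P': "P \<in> carrier_mat n n" using P by (simp add: pos_def_def)
  have c: "e \<in> carrier_vec 1" "y \<in> carrier_vec n"
    using P' z by (simp_all add: e_def y_def)
  have Y: "?Y \<in> carrier_mat n n" "?Y *\<^sub>v (P *\<^sub>v z) = z"
    using mat_inv_pos_def[OF P] assoc_mult_mat_vec[OF mat_inv_pos_def(1)[OF P] P' z] z by simp_all
  have lower: "mat_of_cols n [z] *\<^sub>v e + ?Y *\<^sub>v y = 0\<^sub>v n"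
  proof (rule eq_vecI)
    fix i assume "i < dim_vec (0\<^sub>v n :: rvec)"
    then have i: "i < n" by simp
    have "?Y *\<^sub>v y = (- 1) \<cdot>\<^sub>v z"
      using Y P' z by (simp add: y_def mult_mat_vec[of _ n n])
    then show "vec_index (mat_of_cols n [z] *\<^sub>v e + ?Y *\<^sub>v y) i = vec_index (0\<^sub>v n) i"
      using i Y z by (simp add: e_def scalar_prod_def mat_of_cols_index)
  qed (use Y in simp)
  have upper: "mat 1 1 (\<lambda>_. \<delta>) *\<^sub>v e + mat_of_row z *\<^sub>v y = Matrix.vec 1 (\<lambda>_. \<delta> - scalar_prod z (P *\<^sub>v z))"
    using P' z by (intro eq_vecI) (simp_all add: e_def y_def scalar_prod_def sum_negf)
  have "?M *\<^sub>v (e @\<^sub>v y) = Matrix.vec 1 (\<lambda>_. \<delta> - scalar_prod z (P *\<^sub>v z)) @\<^sub>v 0\<^sub>v n"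
    using Y c z
    by (subst four_block_mat_mult_vec[of _ 1 1 _ n _ n])
       (auto simp: upper lower simp del: One_nat_def)
  then have "scalar_prod (e @\<^sub>v y) (?M *\<^sub>v (e @\<^sub>v y)) = \<delta> - scalar_prod z (P *\<^sub>v z)"
    using c by (simp add: scalar_prod_append[of _ 1 _ n]) (simp add: e_def scalar_prod_def)
  moreover have "e @\<^sub>v y \<noteq> 0\<^sub>v (1 + n)"
  proof
    assume "e @\<^sub>v y = 0\<^sub>v (1 + n)"
    from arg_cong[OF this, of "\<lambda>u. vec_index u 0"] show False
      using c by (simp add: e_def)
  qed
  moreover have "e @\<^sub>v y \<in> carrier_vec (1 + n)"
    using c by (rule append_carrier_vec)
  ultimately show ?thesis
    using pd unfolding pos_def_def by (metis diff_gt_0_iff_gt)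
qed

text \<open>
  For an eigenvector \<open>a + i b\<close> with eigenvalue \<open>\<mu>\<close>, the terms with \<open>Im \<mu>\<close> cancel by symmetry of
  \<open>P\<close>, and \<open>a' P M a + b' P M b = Re \<mu> (a' P a + b' P b)\<close>.
\<close>

lemma hurwitz_of_lyapunov_inequality:
  assumes P: "pos_def n P" and M: "M \<in> carrier_mat n n"
    and decay: "\<And>v. v \<in> carrier_vec n \<Longrightarrow> v \<noteq> 0\<^sub>v n \<Longrightarrow> scalar_prod v (P *\<^sub>v (M *\<^sub>v v)) < 0"
  shows "hurwitz M"
  unfolding hurwitz_def
proof (intro allI impI)
  fix \<mu> assume "eigenvalue (map_mat complex_of_real M) \<mu>"
  then obtain a b where c: "a \<in> carrier_vec n" "b \<in> carrier_vec n"
    and nz: "a \<noteq> 0\<^sub>v n \<or> b \<noteq> 0\<^sub>v n"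
    and Ma: "M *\<^sub>v a = Re \<mu> \<cdot>\<^sub>v a - Im \<mu> \<cdot>\<^sub>v b"
    and Mb: "M *\<^sub>v b = Im \<mu> \<cdot>\<^sub>v a + Re \<mu> \<cdot>\<^sub>v b"
    using complex_eigenvector_real_parts[OF M] by metis
  have P': "P \<in> carrier_mat n n" "transpose_mat P = P"
    using P by (auto simp: pos_def_def)
  let ?d = "\<lambda>v. scalar_prod v (P *\<^sub>v (M *\<^sub>v v))" and ?q = "\<lambda>v. scalar_prod v (P *\<^sub>v v)"
  have zero: "?d (0\<^sub>v n) = 0" "?q (0\<^sub>v n) = 0"
    using P' M by simp_all
  have sum: "?d a + ?d b = Re \<mu> * (?q a + ?q b)"
    using P' c scalar_prod_symmetric[OF P' c]
    by (simp add: Ma Mb mult_add_distrib_mat_vec[of _ n n] mult_minus_distrib_mat_vec[of _ n n]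
        mult_mat_vec[of _ n n] scalar_prod_add_distrib[of _ n] scalar_prod_minus_distrib[of _ n] algebra_simps)
  have "?d v \<le> 0 \<and> 0 \<le> ?q v \<and> (v \<noteq> 0\<^sub>v n \<longrightarrow> ?d v < 0 \<and> 0 < ?q v)" if "v \<in> carrier_vec n" for v
    using decay[OF that] P that zero by (cases "v = 0\<^sub>v n") (auto simp: pos_def_def less_imp_le)
  from this[OF c(1)] this[OF c(2)] have "?d a + ?d b < 0" "0 < ?q a + ?q b"
    using nz by auto
  then show "Re \<mu> < 0"
    unfolding sum by (simp add: mult_less_0_iff)
qed

section \<open>Dissipation along the closed loop\<close>

lemma pos_semidef_Q_weighted:
  assumes g: "valid_game g" and \<alpha>: "\<alpha> \<in> weights g"
  shows "pos_semidef (xdim g) (Q_weighted g \<alpha>)"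
proof -
  have term_i: "pos_semidef (xdim g) (transpose_mat (matC g i) * (\<alpha> i \<cdot>\<^sub>m matQ g i) * matC g i)"
    if "i < num_players g" for i
    using that g \<alpha>
    by (intro pos_semidef_congruence[of "ydim g i"] pos_semidef_smult)
       (auto simp: valid_game_def weights_def less_imp_le)
  have sum_is: "pos_semidef (xdim g) (foldr (+)
      (map (\<lambda>i. transpose_mat (matC g i) * (\<alpha> i \<cdot>\<^sub>m matQ g i) * matC g i) is) (0\<^sub>m (xdim g) (xdim g)))"
    if "set is \<subseteq> {..<num_players g}" for "is"
    using that by (induction "is") (auto intro!: pos_semidef_zero pos_semidef_add term_i)
  show ?thesis
    unfolding Q_weighted_def by (rule sum_is) auto
qed

lemma pos_semidef_R_weighted:
  assumes g: "valid_game g" and \<alpha>: "\<alpha> \<in> weights g"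
  shows "pos_semidef (total_udim g) (R_weighted g \<alpha>)"
proof -
  let ?Rs = "map (\<lambda>i. \<alpha> i \<cdot>\<^sub>m matR g i) [0..<num_players g]"
  have R: "pos_semidef (udim g i) (\<alpha> i \<cdot>\<^sub>m matR g i)" if "i < num_players g" for i
    using that g \<alpha>
    by (intro pos_semidef_smult pos_def_imp_pos_semidef) (auto simp: valid_game_def weights_def less_imp_le)
  then have dim: "dim_row (\<alpha> i \<cdot>\<^sub>m matR g i) = udim g i" if "i < num_players g" for i
    using that unfolding pos_semidef_def by blast
  have "sum_list (map dim_row ?Rs) = sum_list (map (udim g) [0..<num_players g])"
    using dim by (auto intro!: arg_cong[of _ _ sum_list])
  then have "dim_row (diag_block_mat ?Rs) = total_udim g"
    by (simp add: dim_diag_block_mat total_udim_def interv_sum_list_conv_sum_set_nat atLeast0LessThan)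
  moreover have "pos_semidef (dim_row (diag_block_mat ?Rs)) (diag_block_mat ?Rs)"
    using R dim by (intro pos_semidef_diag_block_mat) auto
  ultimately show ?thesis
    by (simp add: R_weighted_def)
qed

lemma closed_loop_carrier:
  assumes "F \<in> carrier_mat m (xdim g)"
  shows "closed_loop g F \<in> carrier_mat (xdim g) (xdim g)"
  using assms by (auto simp: closed_loop_def full_B_def dim_block_row)

lemma scalar_prod_mat_sqrt:
  assumes "pos_semidef n A" and v: "v \<in> carrier_vec n"
  shows "scalar_prod (mat_sqrt A *\<^sub>v v) (mat_sqrt A *\<^sub>v v) = scalar_prod v (A *\<^sub>v v)"
proof -
  note S = mat_sqrt_properties[OF assms(1)]
  have c: "mat_sqrt A \<in> carrier_mat n n" "transpose_mat (mat_sqrt A) = mat_sqrt A"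
    using S(1) by (auto simp: pos_semidef_def)
  have "scalar_prod v (A *\<^sub>v v) = scalar_prod v (mat_sqrt A *\<^sub>v (mat_sqrt A *\<^sub>v v))"
    using S(2) assoc_mult_mat_vec[OF c(1) c(1) v] by simp
  also have "\<dots> = scalar_prod (mat_sqrt A *\<^sub>v v) (mat_sqrt A *\<^sub>v v)"
    using scalar_prod_transpose_mult[OF c(1) v, of "mat_sqrt A *\<^sub>v v"] c v by simp
  finally show ?thesis by simp
qed

text \<open>
  The infinitesimal form of the cost bound: the derivative of \<open>x' P x\<close> along the closed loop
  plus the running cost is negative away from the origin.
\<close>

lemma gain_LMI_imp_dissipation:
  assumes g: "valid_game g" and \<alpha>: "\<alpha> \<in> weights g" and P: "pos_def (xdim g) P"
    and F: "F \<in> carrier_mat (total_udim g) (xdim g)" and lmi: "gain_LMI g \<alpha> P F"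
    and v: "v \<in> carrier_vec (xdim g)" "v \<noteq> 0\<^sub>v (xdim g)"
  shows "2 * scalar_prod v (P *\<^sub>v (closed_loop g F *\<^sub>v v)) + scalar_prod v (Q_weighted g \<alpha> *\<^sub>v v)
    + scalar_prod (F *\<^sub>v v) (R_weighted g \<alpha> *\<^sub>v (F *\<^sub>v v)) < 0"
proof -
  let ?n = "xdim g" and ?m = "total_udim g" and ?M = "closed_loop g F"
  let ?S = "mat_sqrt (Q_weighted g \<alpha>)" and ?T = "mat_sqrt (R_weighted g \<alpha>)"
  let ?L = "transpose_mat ?M * P + P * ?M"
  note Q = pos_semidef_Q_weighted[OF g \<alpha>] and R = pos_semidef_R_weighted[OF g \<alpha>]
  have S: "?S \<in> carrier_mat ?n ?n" and T: "?T \<in> carrier_mat ?m ?m"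
    using mat_sqrt_properties(1)[OF Q] mat_sqrt_properties(1)[OF R] by (auto simp: pos_semidef_def)
  have P': "P \<in> carrier_mat ?n ?n" "transpose_mat P = P"
    using P by (auto simp: pos_def_def)
  have M: "?M \<in> carrier_mat ?n ?n"
    using F by (rule closed_loop_carrier)
  have Mv: "?M *\<^sub>v v \<in> carrier_vec ?n" and Fv: "F *\<^sub>v v \<in> carrier_vec ?m"
    using M F v by auto
  have "scalar_prod v (?L *\<^sub>v v) + scalar_prod (?S *\<^sub>v v) (?S *\<^sub>v v)
      + scalar_prod ((?T * F) *\<^sub>v v) ((?T * F) *\<^sub>v v) < 0"
    using lmi M P' S T F v unfolding gain_LMI_def Let_def
    by (intro neg_def_block_imp_quadratic_bound[of ?n ?n ?m]) auto
  moreover have "scalar_prod v (?L *\<^sub>v v) = 2 * scalar_prod v (P *\<^sub>v (?M *\<^sub>v v))"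
  proof -
    have "scalar_prod v (?L *\<^sub>v v) = scalar_prod v (transpose_mat ?M *\<^sub>v (P *\<^sub>v v)) + scalar_prod v (P *\<^sub>v (?M *\<^sub>v v))"
      using M P' v by (simp add: add_mult_distrib_mat_vec[of _ ?n ?n] scalar_prod_add_distrib[of _ ?n]
          assoc_mult_mat_vec[of _ ?n ?n _ ?n])
    also have "scalar_prod v (transpose_mat ?M *\<^sub>v (P *\<^sub>v v)) = scalar_prod (?M *\<^sub>v v) (P *\<^sub>v v)"
      using scalar_prod_transpose_mult[of "transpose_mat ?M" ?n ?n v "P *\<^sub>v v"] M P' v by simp
    also have "\<dots> = scalar_prod v (P *\<^sub>v (?M *\<^sub>v v))"
      by (rule scalar_prod_symmetric[OF P' Mv v(1)])
    finally show ?thesis by simp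
  qed
  moreover have "scalar_prod ((?T * F) *\<^sub>v v) ((?T * F) *\<^sub>v v) = scalar_prod (F *\<^sub>v v) (R_weighted g \<alpha> *\<^sub>v (F *\<^sub>v v))"
    using scalar_prod_mat_sqrt[OF R Fv] assoc_mult_mat_vec[OF T F v(1)] by simp
  ultimately show ?thesis
    using scalar_prod_mat_sqrt[OF Q v(1)] by simp
qed

lemma gain_LMI_imp_hurwitz:
  assumes g: "valid_game g" and \<alpha>: "\<alpha> \<in> weights g" and P: "pos_def (xdim g) P"
    and F: "F \<in> carrier_mat (total_udim g) (xdim g)" and lmi: "gain_LMI g \<alpha> P F"
  shows "hurwitz (closed_loop g F)"
proof (rule hurwitz_of_lyapunov_inequality[OF P closed_loop_carrier[OF F]])
  fix v :: rvec assume v: "v \<in> carrier_vec (xdim g)" "v \<noteq> 0\<^sub>v (xdim g)"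
  have "0 \<le> scalar_prod v (Q_weighted g \<alpha> *\<^sub>v v)"
    "0 \<le> scalar_prod (F *\<^sub>v v) (R_weighted g \<alpha> *\<^sub>v (F *\<^sub>v v))"
    using pos_semidef_Q_weighted[OF g \<alpha>] pos_semidef_R_weighted[OF g \<alpha>] v F
    by (auto simp: pos_semidef_def)
  then show "scalar_prod v (P *\<^sub>v (closed_loop g F *\<^sub>v v)) < 0"
    using gain_LMI_imp_dissipation[OF assms v] by linarith
qed

text \<open>
  The storage function is \<open>V t = x(t)' P x(t)\<close> for the chosen trajectory \<open>x\<close>.  The strict
  dissipation inequality holds for nonzero states; at the origin it is an equality, hence the
  case distinction.
\<close>

lemma gain_LMI_imp_cost_bound:
  assumes g: "valid_game g" and \<alpha>: "\<alpha> \<in> weights g" and P: "pos_def (xdim g) P"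
    and F: "F \<in> carrier_mat (total_udim g) (xdim g)" and lmi: "gain_LMI g \<alpha> P F"
    and z: "z \<in> carrier_vec (xdim g)"
  shows "cost g \<alpha> z F \<le> ennreal (scalar_prod z (P *\<^sub>v z))"
proof -
  let ?n = "xdim g" and ?m = "total_udim g"
  define M where "M = closed_loop g F"
  define x where "x = state_trajectory g F z"
  define f where "f t = scalar_prod (x t) (Q_weighted g \<alpha> *\<^sub>v x t)
      + scalar_prod (F *\<^sub>v x t) (R_weighted g \<alpha> *\<^sub>v (F *\<^sub>v x t))" for t
  have M: "M \<in> carrier_mat ?n ?n"
    unfolding M_def using F by (rule closed_loop_carrier)
  have "solves_linear_ode M z x"
    using someI_ex[OF linear_ode_solution_exists[OF M z]]
    by (simp add: x_def state_trajectory_def M_def)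
  then have x0: "x 0 = z" and x: "\<And>t. 0 \<le> t \<Longrightarrow> x t \<in> carrier_vec ?n"
    and dx: "\<And>t k. 0 \<le> t \<Longrightarrow> k < ?n \<Longrightarrow>
      ((\<lambda>\<tau>. vec_index (x \<tau>) k) has_real_derivative vec_index (M *\<^sub>v x t) k) (at t within {0..})"
    using M by (auto simp: solves_linear_ode_def)
  have Q: "pos_semidef ?n (Q_weighted g \<alpha>)" and R: "pos_semidef ?m (R_weighted g \<alpha>)"
    using pos_semidef_Q_weighted[OF g \<alpha>] pos_semidef_R_weighted[OF g \<alpha>] by auto
  have P': "P \<in> carrier_mat ?n ?n" "transpose_mat P = P"
    using P by (auto simp: pos_def_def)
  have cx: "continuous_on {0..} (\<lambda>t. vec_index (x t) k)" if "k < ?n" for k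
    by (rule DERIV_continuous_on[where D = "\<lambda>t. vec_index (M *\<^sub>v x t) k"]) (use dx that in auto)
  have Fx: "F *\<^sub>v x t \<in> carrier_vec ?m" if "0 \<le> t" for t
    using F x[OF that] by auto
  have "(\<integral>\<^sup>+t\<in>{0..}. ennreal (f t) \<partial>lborel) \<le> ennreal (scalar_prod (x 0) (P *\<^sub>v x 0))"
  proof (rule nn_integral_le_of_nonneg_storage)
    fix t :: real assume t: "0 \<le> t"
    have Mx: "M *\<^sub>v x t \<in> carrier_vec ?n"
      using M x[OF t] by auto
    show "((\<lambda>t. scalar_prod (x t) (P *\<^sub>v x t)) has_real_derivative
        2 * scalar_prod (x t) (P *\<^sub>v (M *\<^sub>v x t))) (at t within {0..})"
      by (rule has_derivative_quadratic_form[OF P' _ _ Mx]) (use x dx t in auto)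
    show "0 \<le> scalar_prod (x t) (P *\<^sub>v x t)"
      using pos_def_imp_pos_semidef[OF P] x[OF t] by (simp add: pos_semidef_def)
    show "0 \<le> f t"
      using Q R x[OF t] Fx[OF t] by (simp add: f_def pos_semidef_def)
    show "f t \<le> - (2 * scalar_prod (x t) (P *\<^sub>v (M *\<^sub>v x t)))"
    proof (cases "x t = 0\<^sub>v ?n")
      case True
      have F0: "F *\<^sub>v 0\<^sub>v ?n = 0\<^sub>v ?m"
        using F by (intro eq_vecI) auto
      have zero: "scalar_prod (0\<^sub>v k) (A *\<^sub>v u) = 0"
        if "A \<in> carrier_mat k k" "u \<in> carrier_vec k" for k and A :: rmat and u
        using scalar_prod_left_zero[OF mult_mat_vec_carrier[OF that]] .
      have "Q_weighted g \<alpha> \<in> carrier_mat ?n ?n" "R_weighted g \<alpha> \<in> carrier_mat ?m ?m"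
        using Q R by (auto simp: pos_semidef_def)
      then show ?thesis
        using P'(1) M by (simp add: f_def True F0 zero)
    next
      case False
      from gain_LMI_imp_dissipation[OF g \<alpha> P F lmi x[OF t] this] show ?thesis
        by (simp add: f_def M_def)
    qed
  next
    show "continuous_on {0..} f"
      unfolding f_def using Q R Fx x
      by (intro continuous_on_add continuous_on_quadratic_form[where n = ?n]
          continuous_on_quadratic_form[where n = ?m] continuous_on_mult_mat_vec[OF F] cx)
         (auto simp: pos_semidef_def)
  qed
  then show ?thesis
    by (simp add: cost_def Let_def x_def[symmetric] f_def x0)
qed

theorem theorem3:
  fixes g :: lq_game and r \<delta> :: real and \<alpha> :: "nat \<Rightarrow> real" and W :: "real Matrix.mat"
  assumes "valid_game g"
    and "r > 0" and "\<delta> > 0" and "\<alpha> \<in> weights g"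
    and "null_basis_hat_B g W"
  shows
    "((\<Inter>x0\<in>init_ball g r. P_set g \<alpha> \<delta> W x0) \<noteq> {} \<longrightarrow>
       (\<forall>P \<in> (\<Inter>x0\<in>init_ball g r. P_set g \<alpha> \<delta> W x0).
        \<forall>F \<in> carrier_mat (total_udim g) (xdim g).
          gain_LMI g \<alpha> P F \<and> structured g F \<longrightarrow>
            F \<in> guaranteed_cost_controls g \<alpha> r \<delta> \<and> hurwitz (closed_loop g F)))
     \<and>
     (\<forall>x0 \<in> init_ball g r.
        P_set g \<alpha> \<delta> W x0 \<noteq> {} \<longrightarrow>
        (\<forall>P \<in> P_set g \<alpha> \<delta> W x0.
         \<forall>F \<in> carrier_mat (total_udim g) (xdim g).
          gain_LMI g \<alpha> P F \<and> structured g F \<longrightarrow>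
            cost g \<alpha> x0 F < ennreal \<delta> \<and> hurwitz (closed_loop g F)))"
proof -
  have at_point: "cost g \<alpha> x0 F < ennreal \<delta> \<and> hurwitz (closed_loop g F)"
    if x0: "x0 \<in> init_ball g r" and P: "P \<in> P_set g \<alpha> \<delta> W x0"
      and F: "F \<in> carrier_mat (total_udim g) (xdim g)" and lmi: "gain_LMI g \<alpha> P F" for x0 P F
  proof -
    have z: "x0 \<in> carrier_vec (xdim g)"
      using x0 by (simp add: init_ball_def)
    have P': "pos_def (xdim g) P"
      using P by (simp add: P_set_def)
    have "scalar_prod x0 (P *\<^sub>v x0) < \<delta>"
      using P by (intro pos_def_bordered_inverse_imp_bound[OF P' z]) (simp add: P_set_def Y_set_def)
    then have "ennreal (scalar_prod x0 (P *\<^sub>v x0)) < ennreal \<delta>"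
      using \<open>\<delta> > 0\<close> by (intro ennreal_lessI)
    then show ?thesis
      using gain_LMI_imp_cost_bound[OF assms(1,4) P' F lmi z]
        gain_LMI_imp_hurwitz[OF assms(1,4) P' F lmi] by (auto intro: le_less_trans)
  qed
  \<comment> \<open>The ball must be nonempty: otherwise membership in the intersection would say nothing
      about \<open>P\<close>, and \<open>A + B F\<close> could not be shown to be Hurwitz.\<close>
  have "0\<^sub>v (xdim g) \<in> init_ball g r"
    using \<open>r > 0\<close> by (simp add: init_ball_def)
  then show ?thesis
    using at_point unfolding guaranteed_cost_controls_def by blast
qed

end
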